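(* Let $K\subset\mathbb{R}^d$ be a smooth and strictly convex body. If $d=5$ then $H_{\mathrm{sep}}(K)\leq 15$; if $d=6$ then $H_{\mathrm{sep}}(K)\leq 27$; if $d=7$ then $H_{\mathrm{sep}}(K)\leq 63$.
   Context: A convex body in $\mathbb{R}^d$ is a compact convex set with nonempty interior. It is smooth if it has a unique supporting hyperplane at each boundary point, and strictly convex if its boundary contains no nondegenerate line segment. A translative packing of a convex body $K$ is a finite collection $\{x_1+K,\dots,x_n+K\}$ of (distinct) translates of $K$ such that no two of them have interior points in common. Two translates in the packing touch if they have a common boundary point. The packing is totally separable if any two touching translates in it have a separating hyperplane that does not intersect the interior of any translate in the packing. The contact graph of the packing is the graph whose vertices are the translates, two being joined by an edge iff they touch. The separable Hadwiger number $H_{\mathrm{sep}}(K)$ is the maximum degree of a vertex in the contact graph, the maximum being taken over all totally separable packings of translates of $K$. *)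

theory Defs
  imports "HOL-Analysis.Analysis"
begin

definition convex_body :: "'a::euclidean_space set \<Rightarrow> bool" where
  "convex_body K \<longleftrightarrow> compact K \<and> convex K \<and> interior K \<noteq> {}"

text \<open>Hyperplanes are represented as point sets, so that uniqueness of a supporting
  hyperplane does not depend on the choice of its normal vector. Requiring \<open>K\<close> to lie on the
  side \<open>a \<bullet> y \<le> b\<close> is no restriction, since \<open>(a, b)\<close> may be replaced by \<open>(- a, - b)\<close>.\<close>

definition supporting_hyperplane_at ::
    "'a::euclidean_space set \<Rightarrow> 'a \<Rightarrow> 'a set \<Rightarrow> bool" where
  "supporting_hyperplane_at K x H \<longleftrightarrow>
     (\<exists>a b. a \<noteq> 0 \<and> H = {y. a \<bullet> y = b} \<and> x \<in> H \<and> K \<subseteq> {y. a \<bullet> y \<le> b})"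

definition smooth_body :: "'a::euclidean_space set \<Rightarrow> bool" where
  "smooth_body K \<longleftrightarrow> (\<forall>x \<in> frontier K. \<exists>!H. supporting_hyperplane_at K x H)"

definition strictly_convex_body :: "'a::euclidean_space set \<Rightarrow> bool" where
  "strictly_convex_body K \<longleftrightarrow> \<not> (\<exists>x y. x \<noteq> y \<and> closed_segment x y \<subseteq> frontier K)"

text \<open>A packing is a finite set of translates, so its members are automatically distinct.\<close>

definition translative_packing ::
    "'a::euclidean_space set \<Rightarrow> 'a set set \<Rightarrow> bool" where
  "translative_packing K F \<longleftrightarrow>
     finite F \<and> F \<subseteq> range (\<lambda>x. (+) x ` K) \<and>
     pairwise (\<lambda>S T. disjnt (interior S) (interior T)) F"

definition touch :: "'a::euclidean_space set \<Rightarrow> 'a set \<Rightarrow> bool" where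
  "touch S T \<longleftrightarrow> frontier S \<inter> frontier T \<noteq> {}"

definition separating_hyperplane ::
    "'a::euclidean_space set \<Rightarrow> 'a set \<Rightarrow> 'a set \<Rightarrow> bool" where
  "separating_hyperplane S T H \<longleftrightarrow>
     (\<exists>a b. a \<noteq> 0 \<and> H = {y. a \<bullet> y = b} \<and> S \<subseteq> {y. a \<bullet> y \<le> b} \<and> T \<subseteq> {y. a \<bullet> y \<ge> b})"

definition contact_adjacent ::
    "'a::euclidean_space set set \<Rightarrow> 'a set \<Rightarrow> 'a set \<Rightarrow> bool" where
  "contact_adjacent F S T \<longleftrightarrow> S \<in> F \<and> T \<in> F \<and> S \<noteq> T \<and> touch S T"

definition contact_degree :: "'a::euclidean_space set set \<Rightarrow> 'a set \<Rightarrow> nat" where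
  "contact_degree F S = card {T. contact_adjacent F S T}"

definition totally_separable_packing ::
    "'a::euclidean_space set \<Rightarrow> 'a set set \<Rightarrow> bool" where
  "totally_separable_packing K F \<longleftrightarrow>
     translative_packing K F \<and>
     (\<forall>S T. contact_adjacent F S T \<longrightarrow>
        (\<exists>H. separating_hyperplane S T H \<and> (\<forall>U \<in> F. H \<inter> interior U = {})))"

text \<open>The supremum is taken in \<^typ>\<open>enat\<close>, where it would be \<open>\<infinity>\<close> if the degrees were
  unbounded; on \<^typ>\<open>nat\<close> an unbounded supremum would have an unspecified value. When the
  degrees are bounded, it is their maximum.\<close>

definition separable_hadwiger :: "'a::euclidean_space set \<Rightarrow> enat" where
  "separable_hadwiger K =
     Sup {enat (contact_degree F S) | F S. totally_separable_packing K F \<and> S \<in> F}"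

end

theory Submission
  imports Defs
begin

text \<open>
  Let \<open>S\<close> be a translate with neighbours \<open>S + x\<^sub>1, \<dots>, S + x\<^sub>n\<close>. The hyperplane separating \<open>S\<close>
  from \<open>S + x\<^sub>i\<close> passes through a common point, so it supports both translates. It has a normal
  vector \<open>f\<^sub>i\<close> for which \<open>K\<close> has width \<open>1\<close>, and then \<open>f\<^sub>i \<bullet> x\<^sub>i = 1\<close>. A neighbour \<open>S + x\<^sub>j\<close> meets \<open>S\<close>,
  hence \<open>-1 \<le> f\<^sub>i \<bullet> x\<^sub>j \<le> 1\<close>; it is not cut by the hyperplane, hence \<open>f\<^sub>i \<bullet> x\<^sub>j\<close> is not strictly
  between \<open>0\<close> and \<open>1\<close>. By strict convexity \<open>f\<^sub>i\<close> has only one maximizer and one minimizer on \<open>K\<close>,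
  so the value \<open>1\<close> forces \<open>x\<^sub>j = x\<^sub>i\<close> and the value \<open>-1\<close> forces \<open>x\<^sub>j = -x\<^sub>i\<close>.

  So the \<open>n \<times> n\<close> matrix \<open>A = (f\<^sub>i \<bullet> x\<^sub>j)\<close> has rank at most \<open>d\<close>, ones on the diagonal, entries in
  \<open>[-1, 0]\<close> elsewhere, and \<open>-1\<close> at most once in each row. Such a matrix is too close to a diagonal
  one to have small rank: every real matrix satisfies
  \<open>(tr M)\<^sup>2 \<le> rank M * \<parallel>M\<parallel>\<^sup>2\<close> with the Frobenius norm
  (\<open>trace_squared_le_dim_times_frobenius\<close>). To make the norm small compared to the trace,
  the off-diagonal entries are centred: add \<open>1/2\<close> to every entry, which raises the rank by at most
  one. The diagonal becomes \<open>3/2\<close> and the other entries have absolute value at most \<open>1/2\<close>, so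
  \<open>(3n/2)\<^sup>2 \<le> (d + 1) (9n/4 + n(n - 1)/4)\<close>, that is, \<open>9n \<le> (d + 1) (n + 8)\<close>.

  For \<open>d = 5, 6, 7\<close> this reads \<open>n \<le> 16, 28, 64\<close>. The last unit comes from the equality case: equality
  requires every off-diagonal entry of \<open>A\<close> to be \<open>0\<close> or \<open>-1\<close>, but then \<open>\<parallel>A\<parallel>\<^sup>2 \<le> 2n\<close>, and the trace
  inequality for \<open>A\<close> itself gives \<open>n \<le> 2d\<close> (\<open>card_le_nonpositive_system\<close>).
\<close>

section \<open>Trace, rank and Frobenius norm\<close>

text \<open>Gram-Schmidt without normalization, for functions on \<open>I\<close>. Dependent members of the family
  are allowed and, for finite \<open>I\<close>, lead to functions \<open>w b\<close> that vanish on \<open>I\<close>, so that no dimension has to be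
  counted: \<open>B\<close> serves as index set for both families.\<close>

lemma orthogonal_family:
  fixes v :: "'b \<Rightarrow> 'i \<Rightarrow> real"
  assumes "finite B"
  shows "\<exists>w c. (\<forall>b\<in>B. \<forall>b'\<in>B. b \<noteq> b' \<longrightarrow> (\<Sum>i\<in>I. w b i * w b' i) = 0) \<and>
               (\<forall>b\<in>B. \<forall>i\<in>I. v b i = (\<Sum>b'\<in>B. c b b' * w b' i))"
  using assms
proof (induction B)
  case empty
  then show ?case by simp
next
  case (insert a B)
  then obtain w c where
      orth: "\<And>b b'. b \<in> B \<Longrightarrow> b' \<in> B \<Longrightarrow> b \<noteq> b' \<Longrightarrow> (\<Sum>i\<in>I. w b i * w b' i) = 0"
    and rep: "\<And>b i. b \<in> B \<Longrightarrow> i \<in> I \<Longrightarrow> v b i = (\<Sum>b'\<in>B. c b b' * w b' i)"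
    by metis
  define q where "q b = (\<Sum>i\<in>I. w b i * w b i)" for b
  define e where "e b = (\<Sum>i\<in>I. v a i * w b i) / q b" for b
  define r where "r i = v a i - (\<Sum>b\<in>B. e b * w b i)" for i
  \<comment> \<open>If \<open>q b = 0\<close>, then \<open>w b\<close> vanishes on \<open>I\<close>, or \<open>I\<close> is infinite and every sum over \<open>I\<close> is \<open>0\<close>;
    both sides are \<open>0\<close> then, whatever \<open>e b\<close> is.\<close>
  have eq: "e b * q b = (\<Sum>i\<in>I. v a i * w b i)" if "b \<in> B" for b
  proof (cases "q b = 0")
    case True
    show ?thesis
    proof (cases "finite I")
      case fin: True
      then have "\<forall>i\<in>I. w b i * w b i = 0"
        using True by (subst (asm) q_def, subst (asm) sum_nonneg_eq_0_iff) auto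
      then show ?thesis using True by simp
    qed (use True in simp)
  qed (simp add: e_def)
  have r_orth: "(\<Sum>i\<in>I. r i * w b i) = 0" if b: "b \<in> B" for b
  proof -
    have "(\<Sum>i\<in>I. (\<Sum>b'\<in>B. e b' * w b' i) * w b i) =
          (\<Sum>b'\<in>B. e b' * (\<Sum>i\<in>I. w b' i * w b i))"
      by (simp add: sum_distrib_left sum_distrib_right mult.assoc) (rule sum.swap)
    also have "\<dots> = (\<Sum>b'\<in>B. if b' = b then e b * q b else 0)"
      using orth b by (intro sum.cong) (auto simp: q_def)
    also have "\<dots> = e b * q b"
      using insert.hyps b by simp
    finally show ?thesis
      by (simp add: r_def left_diff_distrib sum_subtractf eq[OF b])
  qed
  define w' where "w' = w(a := r)"
  define c' where "c' b = (if b = a then e(a := 1) else (c b)(a := 0))" for b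
  have ne: "b \<noteq> a" if "b \<in> B" for b
    using insert.hyps that by auto
  have orth': "(\<Sum>i\<in>I. w' b i * w' b' i) = 0"
    if "b \<in> insert a B" "b' \<in> insert a B" "b \<noteq> b'" for b b'
    using that orth r_orth unfolding w'_def by (auto simp: mult.commute)
  have rep': "v b i = (\<Sum>b'\<in>insert a B. c' b b' * w' b' i)" if "b \<in> insert a B" "i \<in> I" for b i
  proof -
    have *: "(\<Sum>b'\<in>insert a B. c' b b' * w' b' i) = c' b a * r i + (\<Sum>b'\<in>B. c' b b' * w b' i)"
      using insert.hyps ne by (simp add: w'_def cong: sum.cong)
    show ?thesis
    proof (cases "b = a")
      case True
      have "(\<Sum>b'\<in>B. c' b b' * w b' i) = (\<Sum>b'\<in>B. e b' * w b' i)"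
        using ne True by (intro sum.cong) (auto simp: c'_def)
      then show ?thesis using * True by (simp add: c'_def r_def)
    next
      case False
      have "(\<Sum>b'\<in>B. c' b b' * w b' i) = (\<Sum>b'\<in>B. c b b' * w b' i)"
        using ne False by (intro sum.cong) (auto simp: c'_def)
      then show ?thesis using * False that rep by (simp add: c'_def)
    qed
  qed
  show ?case
    by (intro exI[of _ w'] exI[of _ c'] conjI ballI impI) (rule orth' rep'; assumption)+
qed

text \<open>Orthogonalizing the coordinate functions \<open>j \<mapsto> X j \<bullet> b\<close> writes the matrix \<open>(F i \<bullet> X j)\<close> as a
  sum of \<open>DIM('a)\<close> rank-one matrices \<open>G b i * w b j\<close> that are pairwise orthogonal in the Frobenius
  inner product. For a single rank-one matrix the inequality is that of Cauchy and Schwarz, the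
  squared norms add up, and the square of a sum of \<open>DIM('a)\<close> traces costs the factor
  \<open>DIM('a)\<close>.\<close>

lemma trace_squared_le_dim_times_frobenius:
  fixes F X :: "'i \<Rightarrow> 'a::euclidean_space"
  shows "(\<Sum>i\<in>I. F i \<bullet> X i)\<^sup>2 \<le> DIM('a) * (\<Sum>i\<in>I. \<Sum>j\<in>I. (F i \<bullet> X j)\<^sup>2)"
proof -
  obtain w :: "'a \<Rightarrow> 'i \<Rightarrow> real" and c where
      orth: "\<And>b b'. b \<in> Basis \<Longrightarrow> b' \<in> Basis \<Longrightarrow> b \<noteq> b' \<Longrightarrow> (\<Sum>i\<in>I. w b i * w b' i) = 0"
    and rep: "\<And>b i. b \<in> Basis \<Longrightarrow> i \<in> I \<Longrightarrow> X i \<bullet> b = (\<Sum>b'\<in>Basis. c b b' * w b' i)"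
    using orthogonal_family[OF finite_Basis, where I = I and v = "\<lambda>b i. X i \<bullet> b"] by metis
  define G where "G b i = (\<Sum>b'\<in>Basis. (F i \<bullet> b') * c b' b)" for b i
  define q where "q b = (\<Sum>i\<in>I. (w b i)\<^sup>2)" for b
  have M: "F i \<bullet> X j = (\<Sum>b\<in>Basis. G b i * w b j)" if "j \<in> I" for i j
  proof -
    have "F i \<bullet> X j = (\<Sum>b'\<in>Basis. \<Sum>b\<in>Basis. (F i \<bullet> b') * c b' b * w b j)"
      by (subst euclidean_inner) (simp add: rep that sum_distrib_left mult.assoc)
    also have "\<dots> = (\<Sum>b\<in>Basis. G b i * w b j)"
      by (subst sum.swap) (simp add: G_def sum_distrib_right)
    finally show ?thesis .
  qed
  have row: "(\<Sum>j\<in>I. (F i \<bullet> X j)\<^sup>2) = (\<Sum>b\<in>Basis. (G b i)\<^sup>2 * q b)" for i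
  proof -
    have "(\<Sum>j\<in>I. (F i \<bullet> X j)\<^sup>2) =
          (\<Sum>j\<in>I. \<Sum>b\<in>Basis. \<Sum>b'\<in>Basis. G b i * G b' i * (w b j * w b' j))"
      by (intro sum.cong) (simp_all add: M power2_eq_square sum_product mult_ac)
    also have "\<dots> = (\<Sum>b\<in>Basis. \<Sum>b'\<in>Basis. \<Sum>j\<in>I. G b i * G b' i * (w b j * w b' j))"
      by (subst sum.swap, rule sum.cong[OF refl], rule sum.swap)
    also have "\<dots> = (\<Sum>b\<in>Basis. \<Sum>b'\<in>Basis. if b' = b then (G b i)\<^sup>2 * q b else 0)"
      by (intro sum.cong refl)
         (auto simp: sum_distrib_left[symmetric] orth q_def power2_eq_square)
    also have "\<dots> = (\<Sum>b\<in>Basis. (G b i)\<^sup>2 * q b)"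
      by (intro sum.cong refl) simp
    finally show ?thesis .
  qed
  have "(\<Sum>i\<in>I. F i \<bullet> X i) = (\<Sum>b\<in>Basis. \<Sum>i\<in>I. G b i * w b i)"
    by (subst sum.swap) (simp add: M)
  then have "(\<Sum>i\<in>I. F i \<bullet> X i)\<^sup>2 \<le> DIM('a) * (\<Sum>b\<in>Basis. (\<Sum>i\<in>I. G b i * w b i)\<^sup>2)"
    using sum_squared_le_sum_of_squares[of "\<lambda>b. \<Sum>i\<in>I. G b i * w b i" "Basis :: 'a set"]
    by (simp add: mult.commute)
  also have "\<dots> \<le> DIM('a) * (\<Sum>b\<in>Basis. (\<Sum>i\<in>I. (G b i)\<^sup>2) * q b)"
    unfolding q_def by (intro mult_left_mono sum_mono Cauchy_Schwarz_ineq_sum) auto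
  also have "(\<Sum>b\<in>Basis. (\<Sum>i\<in>I. (G b i)\<^sup>2) * q b) = (\<Sum>i\<in>I. \<Sum>j\<in>I. (F i \<bullet> X j)\<^sup>2)"
    by (simp add: row sum_distrib_right) (rule sum.swap)
  finally show ?thesis .
qed

section \<open>Systems of vectors and functionals\<close>

text \<open>The second alternative comes from the matrix \<open>(F i \<bullet> X j + 1/2)\<close>, which is the matrix of inner
  products of \<open>(F i, 1/2)\<close> and \<open>(X j, 1)\<close> in one dimension more. It is strict as soon as one
  entry lies in the open interval \<open>(-1, 0)\<close>; otherwise the unshifted matrix is sparse and gives
  the first alternative.\<close>

lemma card_le_nonpositive_system:
  fixes F X :: "'i \<Rightarrow> 'a::euclidean_space"
  assumes fin: "finite I"
    and diag: "\<And>i. i \<in> I \<Longrightarrow> F i \<bullet> X i = 1"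
    and off: "\<And>i j. i \<in> I \<Longrightarrow> j \<in> I \<Longrightarrow> i \<noteq> j \<Longrightarrow> -1 \<le> F i \<bullet> X j \<and> F i \<bullet> X j \<le> 0"
    and opposite: "\<And>i j k. i \<in> I \<Longrightarrow> j \<in> I \<Longrightarrow> k \<in> I \<Longrightarrow>
                     F i \<bullet> X j = -1 \<Longrightarrow> F i \<bullet> X k = -1 \<Longrightarrow> j = k"
  shows "card I \<le> 2 * DIM('a) \<or> 9 * card I < (DIM('a) + 1) * (card I + 8)"
proof (cases "\<exists>i\<in>I. \<exists>j\<in>I. i \<noteq> j \<and> F i \<bullet> X j \<notin> {-1, 0}")
  case False
  let ?n = "card I"
  have row: "(\<Sum>j\<in>I. (F i \<bullet> X j)\<^sup>2) \<le> 2" if i: "i \<in> I" for i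
  proof -
    define J where "J = {j\<in>I. F i \<bullet> X j = -1}"
    have "card J \<le> 1"
      using opposite[OF i] fin by (auto simp: J_def card_le_Suc0_iff_eq)
    have "(\<Sum>j\<in>I. (F i \<bullet> X j)\<^sup>2) = (\<Sum>j\<in>I. (if j = i then 1 else 0) + (if j \<in> J then 1 else 0))"
      using False diag i by (intro sum.cong) (auto simp: J_def)
    also have "\<dots> = 1 + real (card (I \<inter> J))"
      using fin i by (simp add: sum.distrib flip: sum.inter_restrict)
    also have "I \<inter> J = J"
      by (auto simp: J_def)
    finally show ?thesis using \<open>card J \<le> 1\<close> by simp
  qed
  have "(real ?n)\<^sup>2 = (\<Sum>i\<in>I. F i \<bullet> X i)\<^sup>2"
    by (simp add: diag)
  also have "\<dots> \<le> DIM('a) * (\<Sum>i\<in>I. \<Sum>j\<in>I. (F i \<bullet> X j)\<^sup>2)"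
    by (rule trace_squared_le_dim_times_frobenius)
  also have "\<dots> \<le> DIM('a) * (\<Sum>i\<in>I. 2 :: real)"
    by (intro mult_left_mono sum_mono row) auto
  finally have "real ?n * real ?n \<le> real (2 * DIM('a)) * real ?n"
    by (simp add: power2_eq_square)
  then have "real ?n \<le> real (2 * DIM('a))"
    by (cases "?n = 0") (auto simp: mult_le_cancel_right)
  then show ?thesis by linarith
next
  case True
  let ?n = "card I"
  from True obtain p q where pq: "p \<in> I" "q \<in> I" "p \<noteq> q" "F p \<bullet> X q \<notin> {-1, 0}" by blast
  define s where "s i j = F i \<bullet> X j + 1/2" for i j
  have s_le: "(s i j)\<^sup>2 \<le> (if j = i then 9/4 else 1/4)" if "i \<in> I" "j \<in> I" for i j
  proof (cases "j = i")
    case False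
    then have "-1 \<le> F i \<bullet> X j \<and> F i \<bullet> X j \<le> 0"
      using off[OF that] by simp
    then have "\<bar>s i j\<bar> \<le> 1/2"
      unfolding s_def by linarith
    then have "(s i j)\<^sup>2 \<le> (1/2)\<^sup>2"
      by (subst abs_le_square_iff[symmetric]) simp
    then show ?thesis
      using False by (simp add: power2_eq_square)
  qed (use diag that in \<open>simp add: s_def power2_eq_square\<close>)
  have s_less: "(s p q)\<^sup>2 < 1/4"
  proof -
    have "-1 < F p \<bullet> X q" "F p \<bullet> X q < 0"
      using off[OF pq(1-3)] pq(4) by auto
    then have "\<bar>s p q\<bar> < 1/2"
      unfolding s_def by linarith
    then have "(s p q)\<^sup>2 < (1/2)\<^sup>2"
      by (rule power2_strict_mono[of "s p q" "1/2", simplified abs_divide abs_one abs_numeral])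
    then show ?thesis by (simp add: power2_eq_square)
  qed
  have inner: "(\<Sum>j\<in>I. if j = i then 9/4 else (1/4::real)) = (real ?n + 8) / 4" if "i \<in> I" for i
  proof -
    have "(\<Sum>j\<in>I. if j = i then 9/4 else (1/4::real)) = (\<Sum>j\<in>I. (if j = i then 2 else 0) + 1/4)"
      by (intro sum.cong) auto
    also have "\<dots> = (real ?n + 8) / 4"
      using fin that by (simp only: sum.distrib) (simp add: field_simps)
    finally show ?thesis .
  qed
  have frob: "(\<Sum>i\<in>I. \<Sum>j\<in>I. (s i j)\<^sup>2) < ?n * ((real ?n + 8) / 4)"
  proof -
    have "(\<Sum>j\<in>I. (s p j)\<^sup>2) < (\<Sum>j\<in>I. if j = p then 9/4 else 1/4)"
      using fin pq(1-3) s_less s_le[OF pq(1)]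
      by (intro sum_strict_mono_ex1 ballI bexI[of _ q]) simp_all
    then have less: "\<exists>i\<in>I. (\<Sum>j\<in>I. (s i j)\<^sup>2) < (\<Sum>j\<in>I. if j = i then 9/4 else 1/4)"
      using pq(1) by (rule bexI)
    have "\<forall>i\<in>I. (\<Sum>j\<in>I. (s i j)\<^sup>2) \<le> (\<Sum>j\<in>I. if j = i then 9/4 else 1/4)"
      by (intro ballI sum_mono s_le)
    then have "(\<Sum>i\<in>I. \<Sum>j\<in>I. (s i j)\<^sup>2) < (\<Sum>i\<in>I. \<Sum>j\<in>I. if j = i then 9/4 else 1/4)"
      using less by (rule sum_strict_mono_ex1[OF fin])
    then show ?thesis by (simp add: inner)
  qed
  have "(3/2 * real ?n)\<^sup>2 = (\<Sum>i\<in>I. (F i, 1/2 :: real) \<bullet> (X i, 1 :: real))\<^sup>2"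
    by (simp add: diag)
  also have "\<dots> \<le> DIM('a \<times> real) * (\<Sum>i\<in>I. \<Sum>j\<in>I. ((F i, 1/2 :: real) \<bullet> (X j, 1 :: real))\<^sup>2)"
    by (rule trace_squared_le_dim_times_frobenius)
  also have "\<dots> = (DIM('a) + 1) * (\<Sum>i\<in>I. \<Sum>j\<in>I. (s i j)\<^sup>2)"
    by (simp add: s_def)
  also have "\<dots> < (DIM('a) + 1) * (?n * ((real ?n + 8) / 4))"
    using frob by (intro mult_strict_left_mono) auto
  finally have "real ?n * (9 * real ?n) < real ?n * (real (DIM('a) + 1) * (real ?n + 8))"
    by (simp add: power2_eq_square field_simps)
  then have "9 * real ?n < real (DIM('a) + 1) * (real ?n + 8)"
    by (auto simp: mult_less_cancel_left)
  then have "real (9 * ?n) < real ((DIM('a) + 1) * (?n + 8))"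
    by (simp add: algebra_simps)
  then show ?thesis by linarith
qed

section \<open>Separating functionals of touching translates\<close>

lemma strictly_convex_unique_maximizer:
  fixes K :: "'a::euclidean_space set"
  assumes "convex_body K" "strictly_convex_body K" "g \<noteq> 0"
    and "y \<in> K" "z \<in> K" and max: "\<And>x. x \<in> K \<Longrightarrow> g \<bullet> x \<le> b" and "g \<bullet> y = b" "g \<bullet> z = b"
  shows "y = z"
proof (rule ccontr)
  assume "y \<noteq> z"
  have "closed_segment y z \<subseteq> frontier K"
  proof
    fix x assume x: "x \<in> closed_segment y z"
    have "x \<in> K"
      using x assms by (meson convex_body_def closed_segment_subset subsetD)
    have "g \<bullet> x = b"
      using x \<open>g \<bullet> y = b\<close> \<open>g \<bullet> z = b\<close>
      by (auto simp: closed_segment_def inner_add_right left_diff_distrib)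
    moreover have "interior K \<subseteq> interior {x. g \<bullet> x \<le> b}"
      by (rule interior_mono) (use max in auto)
    ultimately have "x \<notin> interior K"
      using \<open>g \<noteq> 0\<close> by (auto simp: interior_halfspace_le)
    then show "x \<in> frontier K"
      using \<open>x \<in> K\<close> closure_subset by (auto simp: frontier_def)
  qed
  then show False
    using assms(2) \<open>y \<noteq> z\<close> by (auto simp: strictly_convex_body_def)
qed

text \<open>The normal vector \<open>g\<close> is scaled so that \<open>K\<close> has width \<open>1\<close> in its direction, with \<open>k\<close> a lowest
  and \<open>k + x\<close> a highest point of \<open>K\<close>. The translates \<open>K\<close> and \<open>K + x\<close> then touch at \<open>k + x\<close>.\<close>

definition width_functional :: "'a::euclidean_space set \<Rightarrow> 'a \<Rightarrow> 'a \<Rightarrow> 'a \<Rightarrow> bool" where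
  "width_functional K g k x \<longleftrightarrow>
     g \<bullet> x = 1 \<and> k \<in> K \<and> k + x \<in> K \<and> (\<forall>y\<in>K. g \<bullet> k \<le> g \<bullet> y \<and> g \<bullet> y \<le> g \<bullet> (k + x))"

lemma touching_translates_meet:
  fixes K :: "'a::euclidean_space set"
  assumes "convex_body K" "touch ((+) s ` K) ((+) t ` K)"
  obtains k where "k \<in> K" "k + (t - s) \<in> K"
proof -
  have "closed ((+) v ` K)" for v
    using assms(1) by (auto simp: convex_body_def intro: closed_translation compact_imp_closed)
  then have "frontier ((+) v ` K) \<subseteq> (+) v ` K" for v
    by (rule frontier_subset_closed)
  then obtain p where "p \<in> (+) s ` K" "p \<in> (+) t ` K"
    using assms(2) unfolding touch_def by (meson disjoint_iff subsetD)
  then obtain y k where yk: "y \<in> K" "k \<in> K" "s + y = t + k" by auto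
  then have "k + (t - s) = y" by (simp add: algebra_simps)
  then show ?thesis using that[OF yk(2)] yk(1) by simp
qed

text \<open>A common point of the translates lies on the hyperplane, so it is a highest point of the
  first and a lowest point of the second. The width of \<open>K\<close> in the normal direction is therefore
  attained by \<open>t - s\<close>; it is positive because \<open>K\<close> has interior points, and can be scaled to \<open>1\<close>.\<close>

lemma separating_hyperplane_width_functional:
  fixes K :: "'a::euclidean_space set"
  assumes K: "convex_body K"
    and touch: "touch ((+) s ` K) ((+) t ` K)"
    and sep: "separating_hyperplane ((+) s ` K) ((+) t ` K) H"
  obtains g k where "width_functional K g k (t - s)" "H = {y. g \<bullet> y = g \<bullet> (t + k)}"
proof -
  obtain a b where a: "a \<noteq> 0" and H: "H = {y. a \<bullet> y = b}"
    and sides: "(+) s ` K \<subseteq> {y. a \<bullet> y \<le> b}" "(+) t ` K \<subseteq> {y. a \<bullet> y \<ge> b}"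
    using sep unfolding separating_hyperplane_def by (elim exE conjE)
  have S: "a \<bullet> (s + y) \<le> b" and T: "b \<le> a \<bullet> (t + y)" if "y \<in> K" for y
    using sides that by blast+
  obtain k where k: "k \<in> K" "k + (t - s) \<in> K"
    using touching_translates_meet[OF K touch] .
  have b: "a \<bullet> (t + k) = b"
    using S[OF k(2)] T[OF k(1)] by (simp add: add.commute)
  have bounds: "a \<bullet> k \<le> a \<bullet> y" "a \<bullet> y \<le> a \<bullet> (k + (t - s))" if "y \<in> K" for y
    using S[OF that] T[OF that] b by (auto simp: algebra_simps inner_add_right inner_diff_right)
  have pos: "0 < a \<bullet> (t - s)"
  proof (rule ccontr)
    assume "\<not> ?thesis"
    then have "K \<subseteq> {y. a \<bullet> y = a \<bullet> k}"
      using bounds by (force simp: inner_add_right)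
    then have "interior K \<subseteq> interior {y. a \<bullet> y = a \<bullet> k}" by (rule interior_mono)
    then show False
      using K a by (auto simp: convex_body_def interior_hyperplane)
  qed
  define r where "r = a \<bullet> (t - s)"
  have scale: "(inverse r *\<^sub>R a) \<bullet> y = (a \<bullet> y) / r" for y
    by (simp add: divide_inverse mult.commute)
  show ?thesis
  proof (rule that)
    show "width_functional K (inverse r *\<^sub>R a) k (t - s)"
      unfolding width_functional_def scale
    proof (intro conjI ballI k)
      show "a \<bullet> (t - s) / r = 1"
        using pos by (simp add: r_def)
      show "a \<bullet> k / r \<le> a \<bullet> y / r" "a \<bullet> y / r \<le> a \<bullet> (k + (t - s)) / r" if "y \<in> K" for y
        using pos bounds[OF that] by (simp_all add: r_def divide_right_mono)
    qed
    show "H = {y. (inverse r *\<^sub>R a) \<bullet> y = (inverse r *\<^sub>R a) \<bullet> (t + k)}"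
      using pos unfolding scale H b by (simp add: r_def)
  qed
qed

text \<open>In the normal direction, a translate occupies an interval of length \<open>1\<close>. If it is shifted
  against \<open>s + K\<close> by an amount strictly between \<open>0\<close> and \<open>1\<close>, then the hyperplane at the upper end
  of \<open>s + K\<close> lies strictly between its lowest and its highest point. Interior points near these
  two are on different sides, and the interior is connected.\<close>

lemma width_functional_avoiding_hyperplane:
  fixes K :: "'a::euclidean_space set"
  assumes K: "convex_body K" and g: "width_functional K g k (t - s)"
    and avoid: "{y. g \<bullet> y = g \<bullet> (t + k)} \<inter> interior ((+) u ` K) = {}"
  shows "g \<bullet> (u - s) \<le> 0 \<or> 1 \<le> g \<bullet> (u - s)"
proof (rule ccontr)
  assume "\<not> ?thesis"
  then have between: "0 < g \<bullet> (u - s)" "g \<bullet> (u - s) < 1" by auto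
  let ?c = "g \<bullet> (t + k - u)"
  have gts: "g \<bullet> t = g \<bullet> s + 1"
    using g by (simp add: width_functional_def inner_diff_right)
  have K_closure: "K \<subseteq> closure (interior K)"
    using K convex_closure_interior[of K] closure_subset by (auto simp: convex_body_def)
  have "open {y. g \<bullet> y < ?c}" "k \<in> {y. g \<bullet> y < ?c}" "k \<in> closure (interior K)"
    using between g K_closure gts
    by (auto simp: width_functional_def open_halfspace_lt inner_add_right inner_diff_right)
  then obtain y where y: "y \<in> interior K" "g \<bullet> y < ?c"
    using open_Int_closure_eq_empty by blast
  have "open {y. g \<bullet> y > ?c}" "k + (t - s) \<in> {y. g \<bullet> y > ?c}"
       "k + (t - s) \<in> closure (interior K)"
    using between g K_closure gts
    by (auto simp: width_functional_def open_halfspace_gt inner_add_right inner_diff_right)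
  then obtain z where z: "z \<in> interior K" "g \<bullet> z > ?c"
    using open_Int_closure_eq_empty by blast
  have "connected (interior K)"
    using K by (auto simp: convex_body_def intro: convex_connected convex_interior)
  then obtain x where "x \<in> interior K" "g \<bullet> x = ?c"
    using connected_ivt_hyperplane[OF _ y(1) z(1)] y(2) z(2) by (metis less_imp_le)
  then have "u + x \<in> interior ((+) u ` K)" "g \<bullet> (u + x) = g \<bullet> (t + k)"
    by (auto simp: interior_translation inner_add_right inner_diff_right)
  then show False using avoid by auto
qed

text \<open>A chord \<open>z\<close> of \<open>K\<close> has extreme height \<open>1\<close> or \<open>-1\<close> only if it joins a lowest to a highest point
  of \<open>K\<close>, and these are unique.\<close>

lemma width_functional_difference_body:
  fixes K :: "'a::euclidean_space set"
  assumes K: "convex_body K" "strictly_convex_body K"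
    and g: "width_functional K g k x" and q: "q \<in> K" "q + z \<in> K"
  shows "-1 \<le> g \<bullet> z" "g \<bullet> z \<le> 1" "g \<bullet> z = 1 \<Longrightarrow> z = x" "g \<bullet> z = -1 \<Longrightarrow> z = - x"
proof -
  have gx: "g \<bullet> x = 1" and kK: "k \<in> K" "k + x \<in> K"
    and bounds: "\<And>y. y \<in> K \<Longrightarrow> g \<bullet> k \<le> g \<bullet> y" "\<And>y. y \<in> K \<Longrightarrow> g \<bullet> y \<le> g \<bullet> (k + x)"
    using g by (auto simp: width_functional_def)
  have "g \<noteq> 0" using gx by auto
  have maxi: "y = k + x" if "y \<in> K" "g \<bullet> y = g \<bullet> (k + x)" for y
    by (rule strictly_convex_unique_maximizer[OF K \<open>g \<noteq> 0\<close>, of y "k + x"]) (use kK bounds that in auto)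
  have mini: "y = k" if "y \<in> K" "g \<bullet> y = g \<bullet> k" for y
    by (rule strictly_convex_unique_maximizer[OF K, of "-g" y k "- (g \<bullet> k)"])
       (use \<open>g \<noteq> 0\<close> kK bounds that in auto)
  note qb = bounds[OF q(1)] bounds[OF q(2)]
  show "-1 \<le> g \<bullet> z" "g \<bullet> z \<le> 1"
    using qb gx by (auto simp: inner_add_right)
  show "z = x" if "g \<bullet> z = 1"
  proof -
    have "q = k" "q + z = k + x"
      using qb gx that q by (auto intro!: mini maxi simp: inner_add_right)
    then show ?thesis by simp
  qed
  show "z = - x" if "g \<bullet> z = -1"
  proof -
    have "q = k + x" "q + z = k"
      using qb gx that q by (auto intro!: mini maxi simp: inner_add_right)
    then have "k + (x + z) = k" by (simp add: add.assoc)
    then show ?thesis by (simp add: eq_neg_iff_add_eq_0 add.commute)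
  qed
qed

section \<open>The degree bound\<close>

lemma contact_degree_bound:
  fixes K :: "'a::euclidean_space set"
  assumes K: "convex_body K" "strictly_convex_body K"
    and pack: "totally_separable_packing K P" and S: "S \<in> P"
  defines "n \<equiv> contact_degree P S"
  shows "n \<le> 2 * DIM('a) \<or> 9 * n < (DIM('a) + 1) * (n + 8)"
proof -
  define I where "I = {T. contact_adjacent P S T}"
  have P: "finite P" "P \<subseteq> range (\<lambda>x. (+) x ` K)"
    using pack by (auto simp: totally_separable_packing_def translative_packing_def)
  have "I \<subseteq> P" by (auto simp: I_def contact_adjacent_def)
  then have "finite I" using P(1) finite_subset by blast
  from P(2) have "\<forall>T. \<exists>v. T \<in> P \<longrightarrow> T = (+) v ` K" by blast
  then obtain v where v: "\<And>T. T \<in> P \<Longrightarrow> T = (+) (v T) ` K" by metis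
  define X where "X T = v T - v S" for T
  have X_inj: "T = U" if "T \<in> I" "U \<in> I" "X T = X U" for T U
  proof -
    have "v T = v U" using that by (simp add: X_def)
    moreover have "T \<in> P" "U \<in> P" using that \<open>I \<subseteq> P\<close> by auto
    ultimately show ?thesis using v by metis
  qed
  have touch: "touch ((+) (v S) ` K) ((+) (v T) ` K)" if "T \<in> I" for T
    using that v S unfolding I_def contact_adjacent_def by (metis mem_Collect_eq)
  have "\<exists>g k. width_functional K g k (X T) \<and>
              (\<forall>U\<in>I. g \<bullet> X U \<le> 0 \<or> 1 \<le> g \<bullet> X U)" if T: "T \<in> I" for T
  proof -
    obtain H where "separating_hyperplane S T H" and H: "\<forall>U\<in>P. H \<inter> interior U = {}"
      using pack T unfolding totally_separable_packing_def I_def by blast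
    then have "separating_hyperplane ((+) (v S) ` K) ((+) (v T) ` K) H"
      using v S T \<open>I \<subseteq> P\<close> by (metis subsetD)
    then obtain g k where g: "width_functional K g k (v T - v S)"
        and Hg: "H = {y. g \<bullet> y = g \<bullet> (v T + k)}"
      using separating_hyperplane_width_functional[OF K(1) touch[OF T]] by blast
    have "g \<bullet> X U \<le> 0 \<or> 1 \<le> g \<bullet> X U" if "U \<in> I" for U
    proof -
      have "U \<in> P" using that \<open>I \<subseteq> P\<close> by auto
      then have "H \<inter> interior ((+) (v U) ` K) = {}" using H v by metis
      then show ?thesis
        using width_functional_avoiding_hyperplane[OF K(1) g] unfolding Hg X_def by blast
    qed
    then show ?thesis using g unfolding X_def by blast
  qed
  then obtain F k where F: "\<And>T. T \<in> I \<Longrightarrow> width_functional K (F T) (k T) (X T)"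
      and gap: "\<And>T U. T \<in> I \<Longrightarrow> U \<in> I \<Longrightarrow> F T \<bullet> X U \<le> 0 \<or> 1 \<le> F T \<bullet> X U"
    by metis
  have meet: "\<exists>q. q \<in> K \<and> q + X U \<in> K" if "U \<in> I" for U
    using touching_translates_meet[OF K(1) touch[OF that]] unfolding X_def by metis
  have "card I \<le> 2 * DIM('a) \<or> 9 * card I < (DIM('a) + 1) * (card I + 8)"
  proof (rule card_le_nonpositive_system[OF \<open>finite I\<close>])
    show "F T \<bullet> X T = 1" if "T \<in> I" for T
      using F[OF that] by (simp add: width_functional_def)
    show "-1 \<le> F T \<bullet> X U \<and> F T \<bullet> X U \<le> 0" if "T \<in> I" "U \<in> I" "T \<noteq> U" for T U
    proof -
      obtain q where q: "q \<in> K" "q + X U \<in> K" using meet[OF \<open>U \<in> I\<close>] by blast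
      note D = width_functional_difference_body[OF K F[OF that(1)] q]
      have "F T \<bullet> X U \<noteq> 1" using D(3) X_inj that by metis
      then show ?thesis using D(1,2) gap[OF that(1,2)] by linarith
    qed
    show "U = W" if "T \<in> I" "U \<in> I" "W \<in> I" "F T \<bullet> X U = -1" "F T \<bullet> X W = -1" for T U W
      using meet width_functional_difference_body(4)[OF K F[OF that(1)]] X_inj that by metis
  qed
  then show ?thesis by (simp add: n_def contact_degree_def I_def)
qed

theorem proposition2:
  fixes K :: "(real ^ 'd) set"
  assumes "convex_body K" and "smooth_body K" and "strictly_convex_body K"
  shows "(CARD('d) = 5 \<longrightarrow> separable_hadwiger K \<le> 15) \<and>
         (CARD('d) = 6 \<longrightarrow> separable_hadwiger K \<le> 27) \<and>
         (CARD('d) = 7 \<longrightarrow> separable_hadwiger K \<le> 63)"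
proof -
  have le: "separable_hadwiger K \<le> numeral N"
    if "\<And>n. n \<le> 2 * CARD('d) \<or> 9 * n < (CARD('d) + 1) * (n + 8) \<Longrightarrow> n \<le> numeral N" for N
    unfolding separable_hadwiger_def
  proof (rule Sup_least, clarify)
    fix P S assume "totally_separable_packing K P" "S \<in> P"
    then have "contact_degree P S \<le> numeral N"
      using that contact_degree_bound[OF assms(1,3)] by simp
    then show "enat (contact_degree P S) \<le> numeral N"
      by (simp add: numeral_eq_enat)
  qed
  show ?thesis
    by (intro conjI impI le) auto
qed

end
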